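(* Let $0<q<1$. If $f(z)=z+\sum_{n=2}^\infty a_nz^n\in\mathcal{S}_q$, then for all $n\ge2$, $$|a_n|\le\prod_{j=2}^n\left(\frac{\frac{1-q^{j-1}}{1-q}+1}{\frac{1-q^j}{1-q}-1}\right).$$ Equality holds for the function $F(z)=z+\sum_{n=2}^\infty b_nz^n$ satisfying $\frac{z(D_qF)(z)}{F(z)}=\frac{1+z}{1-z}$.
   Context: Let $\mathbb{D}=\{z\in\mathbb{C}:|z|<1\}$ and let $\mathcal{A}$ be the class of functions $f$ analytic in $\mathbb{D}$ with $f(0)=0$ and $f'(0)=1$. For $0<q<1$ the $q$-difference operator is $(D_qf)(z)=\frac{f(z)-f(qz)}{z(1-q)}$ for $z\ne0$, and $(D_qf)(0)=f'(0)$; thus on power series $D_q$ sends $z^n$ to $\frac{1-q^n}{1-q}z^{n-1}$. The class $\mathcal{S}_q$ consists of all $f\in\mathcal{A}$ with $\operatorname{Re}\left(\frac{z(D_qf)(z)}{f(z)}\right)>0$ for all $z\in\mathbb{D}$ (the quotient taking the value $1$ at $z=0$).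
   Formalization: The extremal F is taken analytic, with its equation holding, only on some disc |z|<r, r≤1, and is not claimed to lie in S_q: its coefficients are forced and its series has radius of convergence q/(2-q)<1, so no such F is analytic in the whole unit disc. *)

theory Defs
  imports "HOL-Complex_Analysis.Complex_Analysis"
begin

definition class_A :: "(complex \<Rightarrow> complex) set" where
  "class_A = {f. f holomorphic_on ball 0 1 \<and> f 0 = 0 \<and> deriv f 0 = 1}"

definition q_diff :: "real \<Rightarrow> (complex \<Rightarrow> complex) \<Rightarrow> complex \<Rightarrow> complex" where
  "q_diff q f z =
     (if z = 0 then deriv f 0
      else (f z - f (of_real q * z)) / (z * (1 - of_real q)))"

text \<open>Since \<open>x / 0 = 0\<close>, this is \<open>0\<close> at a zero \<open>z \<noteq> 0\<close> of \<open>f\<close>, so that a positive real part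
  implies \<open>f z \<noteq> 0\<close>. Nothing is lost at removable singularities: if \<open>f\<close> and
  \<open>q_diff q f\<close> both vanish at \<open>z \<noteq> 0\<close>, then \<open>f\<close> also vanishes at \<open>q z\<close>; were every
  singularity removable, the zeros \<open>q ^ k z\<close> would accumulate at \<open>0\<close>.\<close>
definition q_quot :: "real \<Rightarrow> (complex \<Rightarrow> complex) \<Rightarrow> complex \<Rightarrow> complex" where
  "q_quot q f z = (if z = 0 then 1 else z * q_diff q f z / f z)"

definition class_S :: "real \<Rightarrow> (complex \<Rightarrow> complex) set" where
  "class_S q = {f \<in> class_A. \<forall>z\<in>ball 0 1. Re (q_quot q f z) > 0}"

text \<open>\<open>f z = z + (\<Sum>n\<ge>2. a n * z ^ n)\<close> for \<open>norm z < r\<close>; the values \<open>a 0\<close> and \<open>a 1\<close> are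
  irrelevant.\<close>
definition has_normalized_expansion ::
    "(complex \<Rightarrow> complex) \<Rightarrow> (nat \<Rightarrow> complex) \<Rightarrow> real \<Rightarrow> bool" where
  "has_normalized_expansion f a r \<longleftrightarrow>
     (\<forall>z\<in>ball 0 r. (\<lambda>n. a (n + 2) * z ^ (n + 2)) sums (f z - z))"

definition q_number :: "real \<Rightarrow> nat \<Rightarrow> real" where
  "q_number q n = (1 - q ^ n) / (1 - q)"

definition coeff_bound :: "real \<Rightarrow> nat \<Rightarrow> real" where
  "coeff_bound q n = (\<Prod>j=2..n. (q_number q (j - 1) + 1) / (q_number q j - 1))"

text \<open>The functional equation is equivalent to \<open>F z = F (q z) (1 - z) / (q - (2 - q) z)\<close>, so its
  solution has a pole at \<open>z = q / (2 - q)\<close>, inside the unit disc. It is therefore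
  not a member of \<^term>\<open>class_A\<close>, and the equation is imposed only on
  some disc \<open>ball 0 r\<close>, where the power series of the solution converges.\<close>
definition extremal_on ::
    "real \<Rightarrow> (complex \<Rightarrow> complex) \<Rightarrow> (nat \<Rightarrow> complex) \<Rightarrow> real \<Rightarrow> bool" where
  "extremal_on q F b r \<longleftrightarrow>
     0 < r \<and> r \<le> 1 \<and> has_normalized_expansion F b r \<and>
     (\<forall>z\<in>ball 0 r. q_quot q F z = (1 + z) / (1 - z))"

end

theory Submission
  imports Defs
begin

text \<open>
  If \<open>p = q_quot q f\<close> has positive real part, Caratheodory's bound \<open>\<bar>p\<^sub>k\<bar> \<le> 2\<close> on its Taylor
  coefficients applies. Comparing coefficients in \<open>z D\<^sub>q f = p f\<close> gives
  \<open>([n] - 1) a\<^sub>n = (\<Sum>1 \<le> k < n. p\<^bsub>n-k\<^esub> a\<^sub>k)\<close>, and the numbers that satisfy this recurrence with all \<open>p\<^sub>k\<close>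
  replaced by \<open>2\<close> telescope to the product. For \<open>p = (1 + z) / (1 - z)\<close> every \<open>p\<^sub>k\<close> with \<open>k \<ge> 1\<close>
  equals \<open>2\<close>, which determines the extremal function.
\<close>

section \<open>Taylor coefficients as circle means, and Caratheodory's bound\<close>

text \<open>Cauchy's integral formula for the \<open>k\<close>-th derivative on the circle of radius
  \<open>r\<close>, parametrised over the unit interval. It turns Taylor coefficients into means,
  which can be conjugated and split into real parts.\<close>

lemma has_integral_circle_coeff:
  fixes g :: "complex \<Rightarrow> complex"
  assumes g: "g holomorphic_on ball 0 R" and r: "0 < r" "r < R"
  shows "((\<lambda>t. g (of_real r * exp (2 * of_real pi * \<i> * of_real t)) /
              (of_real r * exp (2 * of_real pi * \<i> * of_real t)) ^ k)
           has_integral (deriv ^^ k) g 0 / fact k) {0..1::real}"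
proof -
  have "((\<lambda>u. g u / (u - 0) ^ Suc k) has_contour_integral
          ((2 * pi * \<i>) / fact k * (deriv ^^ k) g 0)) (circlepath 0 r)"
  proof (rule Cauchy_has_contour_integral_higher_derivative_circlepath)
    show "continuous_on (cball 0 r) g"
      using r by (intro holomorphic_on_imp_continuous_on holomorphic_on_subset[OF g]) auto
    show "g holomorphic_on ball 0 r"
      using r by (intro holomorphic_on_subset[OF g]) auto
  qed (use r in auto)
  then have "((\<lambda>t. (1 / (2 * pi * \<i>)) *
        (g (circlepath 0 r t) / (circlepath 0 r t - 0) ^ Suc k *
         vector_derivative (circlepath 0 r) (at t))) has_integral
        (1 / (2 * pi * \<i>)) * ((2 * pi * \<i>) / fact k * (deriv ^^ k) g 0)) {0..1}"
    unfolding has_contour_integral by (rule has_integral_mult_right)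
  \<comment> \<open>The velocity of the circle is \<open>2 * pi * \<i>\<close> times the point
    itself; it cancels the prefactor and lowers the exponent from \<open>Suc k\<close> to
    \<open>k\<close>.\<close>
  moreover have "(1 / (2 * pi * \<i>)) * (g (circlepath 0 r t) / (circlepath 0 r t - 0) ^ Suc k *
         vector_derivative (circlepath 0 r) (at t)) =
       g (of_real r * exp (2 * of_real pi * \<i> * of_real t)) /
              (of_real r * exp (2 * of_real pi * \<i> * of_real t)) ^ k" for t
    using r unfolding vector_derivative_circlepath by (simp add: circlepath)
  ultimately show ?thesis
    by simp
qed

lemma caratheodory_coeff_bound:
  assumes p: "p holomorphic_on ball 0 1" "p 0 = 1"
    and Re_pos: "\<And>z. z \<in> ball 0 1 \<Longrightarrow> Re (p z) > 0"
  shows "cmod ((deriv ^^ k) p 0 / fact k) \<le> 2"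
proof (cases "k = 0")
  case True
  then show ?thesis using p by simp
next
  case False
  define c where "c = (deriv ^^ k) p 0 / fact k"
  \<comment> \<open>Nothing is known about \<open>p\<close> on the unit circle, so the estimate is
    made on smaller circles, where it carries the factor \<open>r ^ k\<close>.\<close>
  have *: "r ^ k * cmod c \<le> 2" if r: "0 < r" "r < 1" for r :: real
  proof -
    define e where "e t = exp (2 * of_real pi * \<i> * of_real t)" for t :: real
    define h where "h t = p (of_real r * e t)" for t
    have norm_e: "norm (e t) = 1" for t
      by (simp add: e_def)
    have e_nz: "e t \<noteq> 0" for t
      by (simp add: e_def)
    have cnj_e: "cnj (e t) = 1 / e t" for t
      using norm_e[of t] by (simp add: inverse_complex_def divide_conv_cnj)
    \<comment> \<open>The coefficient of index \<open>-k\<close> vanishes, so adding its conjugate replaces \<open>p\<close> by \<open>2 Re p\<close>,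
      whose absolute value has mean \<open>2\<close>.\<close>
    have "((\<lambda>t. h t / (of_real r * e t) ^ k) has_integral c) {0..1}"
      using has_integral_circle_coeff[OF p(1) r, of k] by (simp add: h_def e_def c_def)
    then have "((\<lambda>t. of_real r ^ k * (h t / (of_real r * e t) ^ k)) has_integral of_real r ^ k * c) {0..1}"
      by (rule has_integral_mult_right)
    then have i1: "((\<lambda>t. h t / e t ^ k) has_integral of_real r ^ k * c) {0..1}"
      using r by (simp add: power_mult_distrib)
    \<comment> \<open>Mean value property of \<open>p u * u ^ k\<close>, which vanishes at the
      origin since \<open>k\<close> is nonzero.\<close>
    have "((\<lambda>t. h t * (of_real r * e t) ^ k) has_integral 0) {0..1}"
      using has_integral_circle_coeff[of "\<lambda>u. p u * u ^ k" 1 r 0] p r False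
      by (simp add: h_def e_def holomorphic_on_mult holomorphic_on_power power_0_left)
    then have "((\<lambda>t. (1 / of_real r ^ k) * (h t * (of_real r * e t) ^ k)) has_integral (1 / of_real r ^ k) * 0) {0..1}"
      by (rule has_integral_mult_right)
    then have "((\<lambda>t. h t * e t ^ k) has_integral 0) {0..1}"
      using r by (simp add: power_mult_distrib)
    then have "((\<lambda>t. cnj (h t * e t ^ k)) has_integral cnj 0) {0..1}"
      by (subst (asm) has_integral_cnj [symmetric]) (simp add: o_def)
    then have "((\<lambda>t. cnj (h t) / e t ^ k) has_integral 0) {0..1}"
      by (simp add: cnj_e power_divide)
    from has_integral_add[OF i1 this]
    have i2: "((\<lambda>t. of_real (2 * Re (h t)) / e t ^ k) has_integral of_real r ^ k * c) {0..1}"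
      by (simp flip: add_divide_distrib add: complex_add_cnj)
    have "(h has_integral 1) {0..1}"
      using has_integral_circle_coeff[OF p(1) r, of 0] p(2) by (simp add: h_def [abs_def] e_def)
    then have "((\<lambda>t. Re (h t)) has_integral 1) {0..1}"
      by (metis has_integral_Re one_complex.sel(1))
    from has_integral_mult_right[OF this, of 2]
    have i3: "((\<lambda>t. 2 * Re (h t)) has_integral 2) {0..1}"
      by simp
    have "norm (integral {0..1} (\<lambda>t. of_real (2 * Re (h t)) / e t ^ k))
        \<le> integral {0..1} (\<lambda>t. 2 * Re (h t))"
    proof (rule integral_norm_bound_integral)
      fix t :: real
      have "of_real r * e t \<in> ball 0 1"
        using r by (simp add: norm_mult norm_e)
      then have "Re (h t) > 0"
        unfolding h_def by (rule Re_pos)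
      then show "norm (of_real (2 * Re (h t)) / e t ^ k) \<le> 2 * Re (h t)"
        by (simp add: norm_divide norm_mult norm_power norm_e)
    qed (use i2 i3 in \<open>auto simp: integrable_on_def\<close>)
    then show ?thesis
      unfolding integral_unique[OF i2] integral_unique[OF i3] using r by (simp add: norm_mult norm_power)
  qed
  \<comment> \<open>Letting \<open>r\<close> tend to \<open>1\<close> from the left removes the
    factor \<open>r ^ k\<close>.\<close>
  have "((\<lambda>r. r ^ k * cmod c) \<longlongrightarrow> 1 ^ k * cmod c) (at_left 1)"
    by (intro tendsto_intros)
  moreover have "eventually (\<lambda>r. r ^ k * cmod c \<le> 2) (at_left (1::real))"
    using eventually_at_left_real[of 0 1] by (auto elim!: eventually_mono intro: *)
  ultimately have "1 ^ k * cmod c \<le> 2"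
    by (intro tendsto_upperbound) auto
  then show ?thesis by (simp add: c_def)
qed

section \<open>The q-difference operator on formal power series\<close>

text \<open>The formal counterpart of \<open>z * q_diff q f z\<close> rather than of
  \<open>q_diff q f z\<close>: the extra factor \<open>z\<close> undoes the index shift, so the
  operator acts diagonally on coefficients.\<close>

definition fps_q_diff :: "real \<Rightarrow> complex fps \<Rightarrow> complex fps" where
  "fps_q_diff q \<Phi> = Abs_fps (\<lambda>n. of_real (q_number q n) * fps_nth \<Phi> n)"

lemma fps_nth_fps_q_diff [simp]:
  "fps_nth (fps_q_diff q \<Phi>) n = of_real (q_number q n) * fps_nth \<Phi> n"
  by (simp add: fps_q_diff_def)

lemma q_number_0 [simp]: "q_number q 0 = 0"
  by (simp add: q_number_def)

lemma q_number_1 [simp]: "q \<noteq> 1 \<Longrightarrow> q_number q (Suc 0) = 1"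
  by (simp add: q_number_def)

lemma q_number_nonneg:
  assumes "0 < q" "q < 1"
  shows "q_number q n \<ge> 0"
  using assms by (simp add: q_number_def power_le_one)

lemma q_number_le:
  assumes "0 < q" "q < 1"
  shows "q_number q n \<le> 1 / (1 - q)"
  using assms by (simp add: q_number_def divide_right_mono)

text \<open>Follows from \<open>q ^ n \<le> q ^ 2\<close> and the factorisation of
  \<open>1 - q ^ 2\<close>. It keeps every denominator \<open>q_number q n - 1\<close> of the
  product at least \<open>q\<close>, hence positive.\<close>

lemma q_number_ge:
  assumes "0 < q" "q < 1" "n \<ge> 2"
  shows "q_number q n \<ge> 1 + q"
proof -
  have "q ^ n \<le> q ^ 2"
    using assms by (intro power_decreasing) auto
  then have "(1 + q) * (1 - q) \<le> 1 - q ^ n"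
    by (simp add: algebra_simps power2_eq_square)
  then show ?thesis
    using assms by (simp add: q_number_def pos_le_divide_eq)
qed

text \<open>Replacing \<open>z\<close> by \<open>q * z\<close> composes the series with a linear one
  and so multiplies the \<open>n\<close>-th coefficient by \<open>q ^ n\<close>.\<close>

lemma has_fps_expansion_q_diff:
  assumes f: "f has_fps_expansion \<Phi>"
  shows "(\<lambda>z. (f z - f (of_real q * z)) / (1 - of_real q)) has_fps_expansion fps_q_diff q \<Phi>"
proof -
  have "(f \<circ> (\<lambda>z. of_real q * z)) has_fps_expansion fps_compose \<Phi> (fps_const (of_real q) * fps_X)"
    by (intro has_fps_expansion_compose f fps_expansion_intros) simp
  then have "(\<lambda>z. (1 / (1 - of_real q)) * (f z - f (of_real q * z))) has_fps_expansion
      fps_const (1 / (1 - of_real q)) * (\<Phi> - fps_compose \<Phi> (fps_const (of_real q) * fps_X))"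
    by (intro fps_expansion_intros f) (simp add: o_def)
  also have "fps_const (1 / (1 - of_real q)) * (\<Phi> - fps_compose \<Phi> (fps_const (of_real q) * fps_X))
      = fps_q_diff q \<Phi>"
    by (simp add: fps_eq_iff fps_compose_linear q_number_def left_diff_distrib diff_divide_distrib)
  finally show ?thesis by simp
qed

text \<open>Both series start with the term of degree one, because \<open>q_number q 1 = 1\<close>;
  hence the formal division is exact.\<close>

lemma fps_q_diff_quotient_mult:
  assumes \<Phi>: "fps_nth \<Phi> 0 = 0" "fps_nth \<Phi> 1 = 1" and q: "q \<noteq> 1"
  shows "fps_q_diff q \<Phi> / \<Phi> * \<Phi> = fps_q_diff q \<Phi>"
proof -
  have "subdegree \<Phi> = 1" "subdegree (fps_q_diff q \<Phi>) = 1"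
    using \<Phi> q by (auto intro!: subdegreeI)
  moreover from this have "\<Phi> \<noteq> 0" "fps_q_diff q \<Phi> \<noteq> 0"
    by auto
  ultimately have "\<Phi> dvd fps_q_diff q \<Phi>"
    by (simp add: fps_dvd_iff)
  then show ?thesis
    by (rule dvd_div_mult_self)
qed

lemma has_fps_expansion_q_quot:
  assumes f: "f has_fps_expansion \<Phi>" and \<Phi>: "fps_nth \<Phi> 0 = 0" "fps_nth \<Phi> 1 = 1" and q: "q \<noteq> 1"
  shows "q_quot q f has_fps_expansion fps_q_diff q \<Phi> / \<Phi>"
proof -
  have sub: "subdegree \<Phi> = 1" "subdegree (fps_q_diff q \<Phi>) = 1"
    using \<Phi> q by (auto intro!: subdegreeI)
  \<comment> \<open>The factor \<open>z\<close> cancels against the denominator of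
    \<open>q_diff\<close>. The value \<open>1\<close> at the origin is the ratio of the two leading
    coefficients, as removing the singularity requires.\<close>
  have "(\<lambda>z. if z = 0 then 1 else (f z - f (of_real q * z)) / (1 - of_real q) / f z)
      has_fps_expansion fps_q_diff q \<Phi> / \<Phi>"
    using \<Phi> q sub by (intro has_fps_expansion_divide has_fps_expansion_q_diff f) auto
  also have "(\<lambda>z. if z = 0 then 1 else (f z - f (of_real q * z)) / (1 - of_real q) / f z) = q_quot q f"
    by (auto simp: q_quot_def q_diff_def fun_eq_iff)
  finally show ?thesis .
qed

text \<open>\<open>has_normalized_expansion\<close> leaves \<open>a 0\<close> and \<open>a 1\<close>
  arbitrary, so they are overwritten by the true coefficients \<open>0\<close> and
  \<open>1\<close>.\<close>

definition normalized_fps :: "(nat \<Rightarrow> complex) \<Rightarrow> complex fps" where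
  "normalized_fps a = Abs_fps (\<lambda>n. if n = 0 then 0 else if n = 1 then 1 else a n)"

lemma fps_nth_normalized_fps [simp]:
  "fps_nth (normalized_fps a) 0 = 0"
  "fps_nth (normalized_fps a) (Suc 0) = 1"
  "n \<ge> 2 \<Longrightarrow> fps_nth (normalized_fps a) n = a n"
  by (auto simp: normalized_fps_def)

lemma normalized_fps_sums_iff:
  "(\<lambda>n. fps_nth (normalized_fps a) n * z ^ n) sums w \<longleftrightarrow> (\<lambda>n. a (n + 2) * z ^ (n + 2)) sums (w - z)"
  by (subst sums_iff_shift'[of _ 2, symmetric]) (simp add: numeral_2_eq_2 normalized_fps_def)

lemma has_fps_expansion_normalized:
  assumes "has_normalized_expansion f a r" "r > 0"
  shows "f has_fps_expansion normalized_fps a"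
proof (rule has_fps_expansionI)
  have "eventually (\<lambda>z. z \<in> ball 0 r) (nhds (0::complex))"
    using assms by (intro eventually_nhds_in_open) auto
  then show "\<forall>\<^sub>F z in nhds 0. (\<lambda>n. fps_nth (normalized_fps a) n * z ^ n) sums f z"
    by eventually_elim (use assms in \<open>unfold normalized_fps_sums_iff has_normalized_expansion_def, blast\<close>)
qed

section \<open>The recurrence of the bound and the comparison of coefficients\<close>

lemma coeff_bound_1 [simp]: "coeff_bound q (Suc 0) = 1"
  by (simp add: coeff_bound_def)

lemma coeff_bound_Suc:
  assumes "n \<ge> 1"
  shows "coeff_bound q (Suc n) = coeff_bound q n * ((q_number q n + 1) / (q_number q (Suc n) - 1))"
  using assms by (simp add: coeff_bound_def prod.nat_ivl_Suc')

lemma coeff_bound_nonneg: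
  assumes "0 < q" "q < 1"
  shows "coeff_bound q n \<ge> 0"
  unfolding coeff_bound_def
proof (rule prod_nonneg)
  fix j assume "j \<in> {2..n}"
  then show "0 \<le> (q_number q (j - 1) + 1) / (q_number q j - 1)"
    using q_number_ge[OF assms, of j] q_number_nonneg[OF assms, of "j - 1"] assms by simp
qed

text \<open>The product formula turns the left side at \<open>Suc n\<close> into
  \<open>(q_number q n + 1) * coeff_bound q n\<close>. This exceeds the left side at
  \<open>n\<close> by \<open>2 * coeff_bound q n\<close>, the term by which the right side
  grows.\<close>

lemma coeff_bound_eq_sum:
  assumes q: "0 < q" "q < 1" and n: "n \<ge> 2"
  shows "(q_number q n - 1) * coeff_bound q n = 2 * (\<Sum>k=1..<n. coeff_bound q k)"
  using n
proof (induction n rule: dec_induct)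
  case base
  have "q_number q 2 - 1 \<noteq> 0"
    using q q_number_ge[OF q, of 2] by simp
  moreover have "coeff_bound q 2 = 2 / (q_number q 2 - 1)"
    using q coeff_bound_Suc[of 1 q] by (simp add: numeral_2_eq_2)
  moreover have "{1..<2::nat} = {1}"
    by auto
  ultimately show ?case
    by (simp add: field_simps)
next
  case (step n)
  have "(q_number q (Suc n) - 1) * coeff_bound q (Suc n) = (q_number q n + 1) * coeff_bound q n"
    using step q q_number_ge[OF q, of "Suc n"] by (simp add: coeff_bound_Suc)
  also have "\<dots> = (q_number q n - 1) * coeff_bound q n + 2 * coeff_bound q n"
    by (simp add: algebra_simps)
  also have "\<dots> = 2 * (\<Sum>k=1..<Suc n. coeff_bound q k)"
    using step by (simp add: algebra_simps)
  finally show ?case .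
qed

text \<open>Strong induction: the triangle inequality bounds the recurrence for \<Phi> by the same
  recurrence with every coefficient of \<open>P\<close> replaced by \<open>2\<close>, which
  \<open>coeff_bound\<close> satisfies with equality.\<close>

lemma coeff_le_coeff_bound:
  assumes q: "0 < q" "q < 1"
    and \<Phi>: "fps_nth \<Phi> 0 = 0" "fps_nth \<Phi> 1 = 1" "P * \<Phi> = fps_q_diff q \<Phi>"
    and P: "fps_nth P 0 = 1" "\<And>k. cmod (fps_nth P k) \<le> 2"
    and n: "n \<ge> 1"
  shows "cmod (fps_nth \<Phi> n) \<le> coeff_bound q n"
  using n
proof (induction n rule: less_induct)
  case (less n)
  show ?case
  proof (cases "n = 1")
    case True
    then show ?thesis using \<Phi> by simp
  next
    case False
    with less have n: "n \<ge> 2" by simp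
    have pos: "q_number q n - 1 > 0"
      using q_number_ge[OF q n] q by simp
    have "of_real (q_number q n) * fps_nth \<Phi> n = fps_nth (\<Phi> * P) n"
      using \<Phi>(3) by (simp add: mult.commute)
    also have "\<dots> = (\<Sum>k=0..n. fps_nth \<Phi> k * fps_nth P (n - k))"
      by (simp add: fps_mult_nth)
    \<comment> \<open>The term \<open>k = 0\<close> vanishes. The term \<open>k = n\<close> equals
      the coefficient of \<Phi> itself because \<open>P\<close> has constant term \<open>1\<close>;
      moving it to the left produces \<open>q_number q n - 1\<close>.\<close>
    also have "{0..n} = insert 0 (insert n {1..<n})"
      using n by auto
    also have "(\<Sum>k\<in>\<dots>. fps_nth \<Phi> k * fps_nth P (n - k)) =
        fps_nth \<Phi> n + (\<Sum>k=1..<n. fps_nth \<Phi> k * fps_nth P (n - k))"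
      using n \<Phi> P by simp
    finally have "of_real (q_number q n - 1) * fps_nth \<Phi> n = (\<Sum>k=1..<n. fps_nth \<Phi> k * fps_nth P (n - k))"
      by (simp add: algebra_simps)
    then have "(q_number q n - 1) * cmod (fps_nth \<Phi> n) = cmod (\<Sum>k=1..<n. fps_nth \<Phi> k * fps_nth P (n - k))"
      using pos by (metis abs_of_pos norm_mult norm_of_real)
    also have "\<dots> \<le> (\<Sum>k=1..<n. coeff_bound q k * 2)"
      using less.IH P(2) coeff_bound_nonneg[OF q]
      by (intro order_trans[OF norm_sum] sum_mono) (auto simp: norm_mult intro!: mult_mono)
    also have "\<dots> = (q_number q n - 1) * coeff_bound q n"
      by (simp only: coeff_bound_eq_sum[OF q n] flip: sum_distrib_right)
    finally show ?thesis
      using pos by simp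
  qed
qed

section \<open>The coefficient estimate for the class\<close>

text \<open>The work lies in showing \<open>q_quot q f\<close> holomorphic on the whole disc, so
  that Caratheodory's bound applies: away from the origin \<open>f\<close> has no zeros, and at the
  origin the quotient has a power series.\<close>

lemma class_S_coeff_bound:
  assumes q: "0 < q" "q < 1" and f: "f \<in> class_S q" "has_normalized_expansion f a 1" and n: "n \<ge> 2"
  shows "cmod (a n) \<le> coeff_bound q n"
proof -
  define P where "P = fps_q_diff q (normalized_fps a) / normalized_fps a"
  have exp: "q_quot q f has_fps_expansion P"
    unfolding P_def using q by (intro has_fps_expansion_q_quot has_fps_expansion_normalized[OF f(2)]) auto
  have P: "P * normalized_fps a = fps_q_diff q (normalized_fps a)"
    unfolding P_def using q by (intro fps_q_diff_quotient_mult) auto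
  have Re_pos: "Re (q_quot q f z) > 0" if "z \<in> ball 0 1" for z
    using f(1) that by (auto simp: class_S_def)
  have holf: "f holomorphic_on ball 0 1"
    using f(1) by (auto simp: class_S_def class_A_def)
  \<comment> \<open>At a zero of \<open>f\<close> the convention \<open>x / 0 = 0\<close> would make
    the quotient \<open>0\<close>, against the positive real part.\<close>
  have nz: "f z \<noteq> 0" if "z \<in> ball 0 1 - {0}" for z
    using Re_pos[of z] that by (auto simp: q_quot_def)
  have "q_quot q f holomorphic_on ball 0 1 - {0} \<longleftrightarrow>
      (\<lambda>z. (f z - f (of_real q * z)) / (1 - of_real q) / f z) holomorphic_on ball 0 1 - {0}"
    by (intro holomorphic_cong) (auto simp: q_quot_def q_diff_def)
  moreover have "(\<lambda>z. f (of_real q * z)) holomorphic_on ball 0 1 - {0}"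
  proof -
    have "f \<circ> (\<lambda>z. of_real q * z) holomorphic_on ball 0 1 - {0}"
    proof (rule holomorphic_on_compose_gen[OF _ holf])
      show "(\<lambda>z. of_real q * z) ` (ball 0 1 - {0}) \<subseteq> ball (0::complex) 1"
        using q mult_strict_mono[of q 1 "norm z" 1 for z :: complex] by (auto simp: norm_mult)
    qed (intro holomorphic_intros)
    then show ?thesis by (simp add: o_def)
  qed
  ultimately have "q_quot q f holomorphic_on ball 0 1 - {0}"
    using nz q by (auto intro!: holomorphic_intros holomorphic_on_subset[OF holf])
  then have "q_quot q f analytic_on (ball 0 1 - {0}) \<union> {0}"
    using has_fps_expansion_imp_analytic_0[OF exp]
    by (subst analytic_on_Un) (simp add: analytic_on_open open_delete)
  then have hol: "q_quot q f holomorphic_on ball 0 1"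
    by (intro analytic_imp_holomorphic) (erule analytic_on_subset, auto)
  have "cmod (fps_nth (normalized_fps a) n) \<le> coeff_bound q n"
  proof (rule coeff_le_coeff_bound[OF q _ _ P])
    show "fps_nth P 0 = 1"
      using has_fps_expansion_imp_0_eq_fps_nth_0[OF exp] by (simp add: q_quot_def)
    show "cmod (fps_nth P k) \<le> 2" for k
      unfolding fps_nth_fps_expansion[OF exp]
      using hol Re_pos by (intro caratheodory_coeff_bound) (auto simp: q_quot_def)
  qed (use n in auto)
  then show ?thesis using n by simp
qed

section \<open>The extremal function: uniqueness and existence\<close>

lemma has_fps_expansion_cayley:
  "(\<lambda>z. (1 + z) / (1 - z)) has_fps_expansion (1 + fps_X) / (1 - fps_X :: complex fps)"
  by (intro has_fps_expansion_divide' fps_expansion_intros) auto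

text \<open>Clearing denominators leaves a two-term recurrence whose successive ratios are the
  factors of \<open>coeff_bound\<close>. One direction serves uniqueness of the extremal
  coefficients, the other their existence.\<close>

lemma fps_q_diff_quotient_eq_cayley_iff:
  assumes q: "0 < q" "q < 1" and \<Phi>: "fps_nth \<Phi> 0 = 0" "fps_nth \<Phi> 1 = 1"
  shows "fps_q_diff q \<Phi> / \<Phi> = (1 + fps_X) / (1 - fps_X) \<longleftrightarrow>
         (\<forall>n\<ge>1. fps_nth \<Phi> n = of_real (coeff_bound q n))"
    (is "?L \<longleftrightarrow> ?R")
proof -
  have D: "fps_q_diff q \<Phi> / \<Phi> * \<Phi> = fps_q_diff q \<Phi>"
    using \<Phi> q by (intro fps_q_diff_quotient_mult) auto
  have "\<Phi> \<noteq> 0" using \<Phi> by auto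
  have "is_unit (1 - fps_X :: complex fps)"
    by simp
  then have "(1 - fps_X :: complex fps) dvd 1 + fps_X"
    by (rule unit_imp_dvd)
  then have C: "(1 + fps_X) / (1 - fps_X) * (1 - fps_X) = (1 + fps_X :: complex fps)"
    by (rule dvd_div_mult_self)
  have nz: "(1 - fps_X :: complex fps) \<noteq> 0"
    using \<open>is_unit (1 - fps_X :: complex fps)\<close> not_is_unit_0 by metis
  \<comment> \<open>Formal power series form an integral domain, so multiplying by the nonzero
    series \<open>\<Phi> * (1 - fps_X)\<close> is reversible.\<close>
  have "?L \<longleftrightarrow> (fps_q_diff q \<Phi> / \<Phi>) * (\<Phi> * (1 - fps_X)) = ((1 + fps_X) / (1 - fps_X)) * (\<Phi> * (1 - fps_X))"
    using \<open>\<Phi> \<noteq> 0\<close> nz by (subst mult_cancel_right) simp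
  also have "\<dots> \<longleftrightarrow> (fps_q_diff q \<Phi> / \<Phi> * \<Phi>) * (1 - fps_X) = ((1 + fps_X) / (1 - fps_X) * (1 - fps_X)) * \<Phi>"
    by (simp only: mult_ac)
  also have "\<dots> \<longleftrightarrow> fps_q_diff q \<Phi> - fps_X * fps_q_diff q \<Phi> = \<Phi> + fps_X * \<Phi>"
    unfolding C D by (simp only: ring_distribs mult_1_left mult_1_right mult.commute)
  also have "\<dots> \<longleftrightarrow> (\<forall>n. of_real (q_number q (Suc n) - 1) * fps_nth \<Phi> (Suc n) =
      of_real (q_number q n + 1) * fps_nth \<Phi> n)"
    (is "_ \<longleftrightarrow> (\<forall>n. ?rec n)")
  proof -
    have eq: "fps_nth (fps_q_diff q \<Phi> - fps_X * fps_q_diff q \<Phi>) (Suc n) =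
              fps_nth (\<Phi> + fps_X * \<Phi>) (Suc n) \<longleftrightarrow> ?rec n" for n
      by (simp add: algebra_simps)
    have eq0: "fps_nth (fps_q_diff q \<Phi> - fps_X * fps_q_diff q \<Phi>) 0 = fps_nth (\<Phi> + fps_X * \<Phi>) 0"
      using \<Phi> by simp
    show ?thesis
      unfolding fps_eq_iff using eq eq0 by (metis not0_implies_Suc)
  qed
  also have "\<dots> \<longleftrightarrow> ?R"
  proof
    assume rec: "\<forall>n. ?rec n"
    have "fps_nth \<Phi> n = of_real (coeff_bound q n)" if "n \<ge> 1" for n
      using that
    proof (induction n rule: dec_induct)
      case base
      show ?case using \<Phi> by simp
    next
      case (step n)
      have "q_number q (Suc n) - 1 \<noteq> 0"
        using q_number_ge[OF q, of "Suc n"] step q by simp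
      then have "fps_nth \<Phi> (Suc n) = of_real (q_number q n + 1) * fps_nth \<Phi> n / of_real (q_number q (Suc n) - 1)"
        using rec[rule_format, of n] by (metis nonzero_mult_div_cancel_left of_real_eq_0_iff)
      then show ?case
        using step by (simp add: coeff_bound_Suc mult.commute)
    qed
    then show ?R by blast
  next
    assume R: ?R
    show "\<forall>n. ?rec n"
    proof
      fix n
      show "?rec n"
      \<comment> \<open>For \<open>n = 0\<close> the recurrence reads \<open>0 = 0\<close>, since
        \<open>q_number q 1 - 1\<close> and the constant term of \<Phi> both vanish.\<close>
      proof (cases "n = 0")
        case True
        then show ?thesis using \<Phi> q by simp
      next
        case False
        then have "(q_number q (Suc n) - 1) * coeff_bound q (Suc n) = (q_number q n + 1) * coeff_bound q n"
          using q_number_ge[OF q, of "Suc n"] q by (simp add: coeff_bound_Suc)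
        then show ?thesis
          using R False by (metis Suc_le_eq bot_nat_0.not_eq_extremum le_SucI of_real_mult One_nat_def)
      qed
    qed
  qed
  finally show ?thesis .
qed

text \<open>The functional equation on any disc around the origin, however small, equates the formal
  quotient with the expansion of \<open>(1 + z) / (1 - z)\<close>, since expansions at a point are
  unique.\<close>

lemma extremal_on_coeff:
  assumes q: "0 < q" "q < 1" and G: "extremal_on q G c s" and n: "n \<ge> 2"
  shows "c n = of_real (coeff_bound q n)"
proof -
  have exp: "q_quot q G has_fps_expansion fps_q_diff q (normalized_fps c) / normalized_fps c"
    using G q by (intro has_fps_expansion_q_quot has_fps_expansion_normalized[of G c s])
      (auto simp: extremal_on_def)
  have "eventually (\<lambda>z. z \<in> ball 0 s) (nhds (0::complex))"
    using G by (intro eventually_nhds_in_open) (auto simp: extremal_on_def)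
  then have "eventually (\<lambda>z. q_quot q G z = (1 + z) / (1 - z)) (nhds 0)"
    by eventually_elim (use G in \<open>auto simp: extremal_on_def\<close>)
  then have "(\<lambda>z. (1 + z) / (1 - z)) has_fps_expansion fps_q_diff q (normalized_fps c) / normalized_fps c"
    using exp by (subst (asm) has_fps_expansion_cong) auto
  then have "fps_q_diff q (normalized_fps c) / normalized_fps c = (1 + fps_X) / (1 - fps_X)"
    using has_fps_expansion_cayley by (rule fps_expansion_unique_complex)
  then have "\<forall>n\<ge>1. fps_nth (normalized_fps c) n = of_real (coeff_bound q n)"
    using q by (subst (asm) fps_q_diff_quotient_eq_cayley_iff) auto
  then show ?thesis
    using n by (metis fps_nth_normalized_fps(3) one_le_numeral order_trans)
qed

text \<open>Each factor has numerator at most \<open>1 / (1 - q) + 1\<close> and denominator at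
  least \<open>q\<close>. The crude geometric growth suffices for a positive radius of
  convergence.\<close>

lemma coeff_bound_le_power:
  assumes q: "0 < q" "q < 1"
  shows "coeff_bound q n \<le> ((1 / (1 - q) + 1) / q) ^ n"
proof -
  define C where "C = (1 / (1 - q) + 1) / q"
  have C: "C \<ge> 1"
    using q by (simp add: C_def pos_le_divide_eq add_increasing)
  have "coeff_bound q n \<le> (\<Prod>j=2..n. C)"
    unfolding coeff_bound_def
  proof (rule prod_mono)
    fix j assume "j \<in> {2..n}"
    then have "q_number q j - 1 \<ge> q"
      using q_number_ge[OF q, of j] by simp
    then show "0 \<le> (q_number q (j - 1) + 1) / (q_number q j - 1) \<and>
          (q_number q (j - 1) + 1) / (q_number q j - 1) \<le> C"
      using q q_number_le[OF q, of "j - 1"] q_number_nonneg[OF q, of "j - 1"]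
      unfolding C_def by (intro conjI divide_nonneg_nonneg frac_le) auto
  qed
  also have "\<dots> = C ^ (n - 1)"
    by simp
  also have "\<dots> \<le> C ^ n"
    using C by (intro power_increasing) auto
  finally show ?thesis by (simp add: C_def)
qed

lemma extremal_on_exists:
  assumes q: "0 < q" "q < 1"
  shows "\<exists>F r. extremal_on q F (\<lambda>n. of_real (coeff_bound q n)) r"
proof -
  define \<Phi> where "\<Phi> = normalized_fps (\<lambda>n. of_real (coeff_bound q n))"
  define C where "C = (1 / (1 - q) + 1) / q"
  define F where "F = eval_fps \<Phi>"
  have \<Phi>_nth: "fps_nth \<Phi> 0 = 0" "fps_nth \<Phi> 1 = 1" "\<forall>n\<ge>1. fps_nth \<Phi> n = of_real (coeff_bound q n)"
    by (auto simp: \<Phi>_def normalized_fps_def)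
  have C: "C > 0"
    using q by (simp add: C_def add_pos_pos)
  \<comment> \<open>At the point \<open>1 / (2 * C)\<close> the terms are dominated by those of the
    geometric series of ratio \<open>1 / 2\<close>.\<close>
  have "summable (\<lambda>n. fps_nth \<Phi> n * of_real (1 / (2 * C)) ^ n)"
  proof (rule summable_comparison_test)
    have "norm (fps_nth \<Phi> n * of_real (1 / (2 * C)) ^ n) \<le> (1 / 2) ^ n" if "n \<ge> 1" for n
    proof -
      have "norm (fps_nth \<Phi> n * of_real (1 / (2 * C)) ^ n) = coeff_bound q n * (1 / (2 * C)) ^ n"
        using that \<Phi>_nth(3) C coeff_bound_nonneg[OF q, of n] by (simp add: norm_mult norm_power norm_divide)
      also have "\<dots> \<le> C ^ n * (1 / (2 * C)) ^ n"
        using C coeff_bound_le_power[OF q, of n] unfolding C_def[symmetric]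
        by (intro mult_right_mono) auto
      also have "\<dots> = (1 / 2) ^ n"
        using C by (simp flip: power_mult_distrib)
      finally show ?thesis .
    qed
    then show "\<exists>N. \<forall>n\<ge>N. norm (fps_nth \<Phi> n * of_real (1 / (2 * C)) ^ n) \<le> (1 / 2) ^ n"
      by blast
  qed (simp add: summable_geometric)
  then have "fps_conv_radius \<Phi> \<ge> norm (of_real (1 / (2 * C)) :: complex)"
    unfolding fps_conv_radius_def by (rule conv_radius_geI)
  moreover have "ereal (norm (of_real (1 / (2 * C)) :: complex)) > 0"
    using C by (simp add: norm_divide)
  ultimately have rad: "fps_conv_radius \<Phi> > 0"
    by (rule less_le_trans[rotated])
  then have F: "F has_fps_expansion \<Phi>"
    by (simp add: F_def has_fps_expansion_def)
  have "q_quot q F has_fps_expansion fps_q_diff q \<Phi> / \<Phi>"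
    using q \<Phi>_nth by (intro has_fps_expansion_q_quot F) auto
  then have "q_quot q F has_fps_expansion (1 + fps_X) / (1 - fps_X)"
    using fps_q_diff_quotient_eq_cayley_iff[OF q \<Phi>_nth(1,2)] \<Phi>_nth(3) by simp
  \<comment> \<open>Two functions with the same expansion both agree near the origin with the sum of
    that series.\<close>
  then have "eventually (\<lambda>z. q_quot q F z = (1 + z) / (1 - z)) (nhds 0)"
    using has_fps_expansion_cayley unfolding has_fps_expansion_def by (auto elim: eventually_elim2)
  moreover have "eventually (\<lambda>z. z \<in> eball 0 (fps_conv_radius \<Phi>)) (nhds 0)"
    using rad by (intro eventually_nhds_in_open) (auto simp: zero_ereal_def)
  then have "eventually (\<lambda>z. (\<lambda>n. fps_nth \<Phi> n * z ^ n) sums F z) (nhds 0)"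
    by eventually_elim (auto simp: F_def intro!: sums_eval_fps)
  ultimately have "eventually (\<lambda>z. q_quot q F z = (1 + z) / (1 - z) \<and>
      (\<lambda>n. fps_nth \<Phi> n * z ^ n) sums F z) (nhds 0)"
    by (rule eventually_conj)
  then obtain d where d: "d > 0" "\<And>z. dist z 0 < d \<Longrightarrow> q_quot q F z = (1 + z) / (1 - z) \<and>
      (\<lambda>n. fps_nth \<Phi> n * z ^ n) sums F z"
    unfolding eventually_nhds_metric by blast
  \<comment> \<open>The minimum with \<open>1\<close> meets the requirement \<open>r \<le> 1\<close>
    of \<open>extremal_on\<close>.\<close>
  have "extremal_on q F (\<lambda>n. of_real (coeff_bound q n)) (min d 1)"
    using d unfolding extremal_on_def has_normalized_expansion_def \<Phi>_def normalized_fps_sums_iff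
    by (auto simp: dist_commute)
  then show ?thesis by blast
qed

theorem theorem3p4:
  fixes q :: real
  assumes "0 < q" and "q < 1"
  shows "(\<forall>f a. f \<in> class_S q \<and> has_normalized_expansion f a 1 \<longrightarrow>
            (\<forall>n\<ge>2. cmod (a n) \<le> coeff_bound q n)) \<and>
         (\<exists>F b r. extremal_on q F b r \<and>
            (\<forall>n\<ge>2. cmod (b n) = coeff_bound q n) \<and>
            (\<forall>G c s. extremal_on q G c s \<longrightarrow> (\<forall>n\<ge>2. c n = b n)))"
proof (intro conjI)
  show "\<forall>f a. f \<in> class_S q \<and> has_normalized_expansion f a 1 \<longrightarrow>
            (\<forall>n\<ge>2. cmod (a n) \<le> coeff_bound q n)"
    using class_S_coeff_bound[OF assms] by blast
  \<comment> \<open>The coefficients of this witness are the bounds themselves, which are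
    nonnegative reals, so their moduli attain the estimate.\<close>
  obtain F r where "extremal_on q F (\<lambda>n. of_real (coeff_bound q n)) r"
    using extremal_on_exists[OF assms] by blast
  moreover have "cmod (of_real (coeff_bound q n)) = coeff_bound q n" for n
    using coeff_bound_nonneg[OF assms] by simp
  ultimately show "\<exists>F b r. extremal_on q F b r \<and>
            (\<forall>n\<ge>2. cmod (b n) = coeff_bound q n) \<and>
            (\<forall>G c s. extremal_on q G c s \<longrightarrow> (\<forall>n\<ge>2. c n = b n))"
    using extremal_on_coeff[OF assms] by blast
qed

end
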